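(* Let $X$ be a non-Archimedean normed space and $Y$ a complete non-Archimedean normed space, both over a field $\mathbb{K}$ with non-trivial non-Archimedean valuation $|\cdot|$. Let $\varphi:X^3\to[0,\infty)$ be a function such that there exists $\alpha<1$ with $$\varphi\left(\frac{x}{2},\frac{y}{2},\frac{z}{2}\right)\le \frac{\alpha\,\varphi(x,y,z)}{|2|}\quad\text{for all }x,y,z\in X.$$ Let $f:X\to Y$ be a mapping satisfying $$\left\|f\left(\frac{x+y+z}{2}\right)+f\left(\frac{x-y+z}{2}\right)-f(x)-f(z)\right\|_Y\le\varphi(x,y,z)\quad\text{for all }x,y,z\in X.$$ Then there exists a unique additive mapping $L:X\to Y$ such that $$\|f(x)-L(x)\|_Y\le\frac{\alpha\,\varphi(x,2x,x)}{|2|-|2|\alpha}\quad\text{for all }x\in X.$$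
   Context: A non-Archimedean valuation on a field $\mathbb{K}$ is a function $|\cdot|:\mathbb{K}\to[0,\infty)$ with $|r|=0$ iff $r=0$, $|rs|=|r||s|$, and $|r+s|\le\max\{|r|,|s|\}$. A non-Archimedean normed space over $\mathbb{K}$ is a vector space $X$ with $\|\cdot\|:X\to\mathbb{R}$ such that $\|x\|=0$ iff $x=0$, $\|rx\|=|r|\|x\|$, and $\|x+y\|\le\max\{\|x\|,\|y\|\}$. A sequence $\{x_n\}$ is Cauchy if $x_{n+1}-x_n\to0$; the space is complete if every Cauchy sequence converges. $|2|$ is the valuation of $2\in\mathbb{K}$; since division by $2$ is used, $2\ne0$ in $\mathbb{K}$. A mapping $L$ is additive if $L(x+y)=L(x)+L(y)$ for all $x,y$.
   Formalization: The formal theorem adds the hypothesis f(0) = 0; without it the claim is false: a nonzero constant mapping f with φ = 0 satisfies every hypothesis, but the conclusion at x = 0 would force f(0) = 0. *)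

theory Defs
  imports Complex_Main
begin

locale nonarch_valuation =
  fixes val :: "'k::field \<Rightarrow> real"
  assumes val_nonneg: "0 \<le> val r"
    and val_eq_0_iff: "val r = 0 \<longleftrightarrow> r = 0"
    and val_mult: "val (r * s) = val r * val s"
    and val_add_le: "val (r + s) \<le> max (val r) (val s)"

text \<open>The trivial valuation takes only the values 0 and 1.\<close>

locale nontrivial_nonarch_valuation = nonarch_valuation +
  assumes val_nontrivial: "\<exists>r. val r \<noteq> 0 \<and> val r \<noteq> 1"

text \<open>
  The library class of normed spaces is tied to real scalars, so the space is given by an
  explicit scalar multiplication and an explicit norm on an abelian group.
\<close>

locale nonarch_normed_space =
  nonarch_valuation val + vector_space scale
  for val :: "'k::field \<Rightarrow> real"
    and scale :: "'k \<Rightarrow> 'v::ab_group_add \<Rightarrow> 'v" +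
  fixes nrm :: "'v \<Rightarrow> real"
  assumes nrm_eq_0_iff: "nrm x = 0 \<longleftrightarrow> x = 0"
    and nrm_scale: "nrm (scale r x) = val r * nrm x"
    and nrm_add_le: "nrm (x + y) \<le> max (nrm x) (nrm y)"

text \<open>
  By the ultrametric inequality, it suffices for the Cauchy property to look at consecutive
  terms of the sequence.
\<close>

definition nonarch_Cauchy :: "('v::ab_group_add \<Rightarrow> real) \<Rightarrow> (nat \<Rightarrow> 'v) \<Rightarrow> bool"
  where "nonarch_Cauchy nrm u \<longleftrightarrow> (\<lambda>n. nrm (u (Suc n) - u n)) \<longlonglongrightarrow> 0"

definition nonarch_convergent :: "('v::ab_group_add \<Rightarrow> real) \<Rightarrow> (nat \<Rightarrow> 'v) \<Rightarrow> bool"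
  where "nonarch_convergent nrm u \<longleftrightarrow> (\<exists>l. (\<lambda>n. nrm (u n - l)) \<longlonglongrightarrow> 0)"

locale complete_nonarch_normed_space = nonarch_normed_space +
  assumes nonarch_complete: "nonarch_Cauchy nrm u \<Longrightarrow> nonarch_convergent nrm u"

text \<open>
  A nonzero constant map solves the Cauchy-Jensen equation exactly (take \<open>\<phi> = 0\<close>) but lies at
  distance 0 from no additive map.  A stability theorem for this equation therefore needs the
  normalisation \<open>f 0 = 0\<close>.
\<close>

lemma (in nonarch_normed_space) constant_not_near_additive:
  fixes f :: "'x::ab_group_add \<Rightarrow> 'v" and \<phi> :: "'x \<Rightarrow> 'x \<Rightarrow> 'x \<Rightarrow> real"
    and half :: "'x \<Rightarrow> 'x" and \<alpha> :: real
  assumes "c \<noteq> 0" and f: "f = (\<lambda>x. c)" and \<phi>: "\<phi> = (\<lambda>x y z. 0)"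
  shows "\<phi> (half x) (half y) (half z) \<le> \<alpha> * \<phi> x y z / val 2"
    and "nrm (f (half (x + y + z)) + f (half (x - y + z)) - f x - f z) \<le> \<phi> x y z"
    and "\<not> (\<exists>L. Modules.additive L \<and>
           (\<forall>x. nrm (f x - L x) \<le> \<alpha> * \<phi> x (x + x) x / (val 2 - val 2 * \<alpha>)))"
proof -
  have nonneg: "0 \<le> nrm w" for w :: 'v
  proof -
    have z: "nrm 0 = 0" by (simp add: nrm_eq_0_iff)
    have "val (-1) * val (-1) = 1 * val 1" using val_mult[of "-1" "-1"] by simp
    moreover have "val 1 = 1"
      using val_mult[of 1 1] val_eq_0_iff[of 1] by simp
    ultimately have "val (-1) = 1"
      using val_nonneg[of "-1"] by (simp add: square_eq_1_iff)
    then have "nrm (- w) = nrm w" using nrm_scale[of "-1" w] by simp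
    then show ?thesis using nrm_add_le[of w "- w"] z by simp
  qed
  show "\<phi> (half x) (half y) (half z) \<le> \<alpha> * \<phi> x y z / val 2" by (simp add: \<phi>)
  show "nrm (f (half (x + y + z)) + f (half (x - y + z)) - f x - f z) \<le> \<phi> x y z"
    using nrm_eq_0_iff[of 0] by (simp add: f \<phi>)
  show "\<not> (\<exists>L. Modules.additive L \<and>
           (\<forall>x. nrm (f x - L x) \<le> \<alpha> * \<phi> x (x + x) x / (val 2 - val 2 * \<alpha>)))"
  proof
    assume "\<exists>L. Modules.additive L \<and>
           (\<forall>x. nrm (f x - L x) \<le> \<alpha> * \<phi> x (x + x) x / (val 2 - val 2 * \<alpha>))"
    then obtain L where L: "Modules.additive L" "\<forall>x. nrm (f x - L x) \<le> 0"
      unfolding \<phi> by auto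
    have "nrm c \<le> 0" using Modules.additive.zero[OF L(1)] spec[OF L(2), of 0] by (simp add: f)
    then have "nrm c = 0" using nonneg[of c] by simp
    then show False using \<open>c \<noteq> 0\<close> by (simp add: nrm_eq_0_iff)
  qed
qed

end

theory Submission
  imports Defs
begin

text \<open>
  Substituting \<open>y = x + z\<close> into the functional inequality turns its first argument into \<open>x + z\<close>
  and its second into \<open>0\<close>.  Since \<open>f 0 = 0\<close>, the Cauchy-Jensen inequality thus contains a bound
  on the additivity defect, \<open>\<parallel>f (x + z) - f x - f z\<parallel> \<le> \<phi> x (x + z) z\<close>, and the theorem reduces to
  the stability of Cauchy's equation, which is proved by Hyers' direct method.

  The additive map is the limit of \<open>u\<^sub>n x = 2\<^sup>n f (x / 2\<^sup>n)\<close>.  The contraction property of the control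
  function shrinks the bound on the defect of \<open>f\<close> at \<open>(x / 2\<^sup>n, z / 2\<^sup>n)\<close> by \<open>(\<alpha> / \<bar>2\<bar>)\<^sup>n\<close>, while the
  factor \<open>2\<^sup>n\<close> costs only \<open>\<bar>2\<bar>\<^sup>n\<close>; so \<open>u\<^sub>n\<close> has defect at most \<open>\<alpha>\<^sup>n \<phi> x (x + z) z\<close>.  Taken on the
  diagonal this makes consecutive terms close, hence \<open>u\<close> is Cauchy, and taken at arbitrary points
  it makes the limit additive (\<open>cauchy_equation_stable\<close>).  By the ultrametric inequality the
  distance from \<open>f x\<close> to the limit is at most the largest of the bounds on the single steps.  This
  is the bound on the first step, \<open>\<alpha> / \<bar>2\<bar> * \<phi> x (2 x) x\<close>, which for \<open>\<alpha> \<ge> 0\<close> implies the asserted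
  one, larger by the factor \<open>1 / (1 - \<alpha>)\<close>.

  Uniqueness uses the same scaling: additive maps commute with dyadic rescaling, so a bound on the
  difference of two of them improves by the factor \<open>\<alpha>\<^sup>n\<close> for every \<open>n\<close>
  (\<open>additive_eq_if_close\<close>).

  A negative \<open>\<alpha>\<close> is possible only if \<open>\<phi>\<close> vanishes identically, so the estimates may be run with
  \<open>max \<alpha> 0\<close> in place of \<open>\<alpha>\<close>.
\<close>

section \<open>Ultrametric limits\<close>

context nonarch_valuation
begin

lemma val_pos: "r \<noteq> 0 \<Longrightarrow> 0 < val r"
  using val_nonneg[of r] val_eq_0_iff[of r] by linarith

lemma val_one: "val 1 = 1"
  using val_mult[of 1 1] val_eq_0_iff[of 1] by simp

lemma val_minus_one: "val (-1) = 1"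
proof -
  have "val (-1) * val (-1) = 1"
    using val_mult[of "-1" "-1"] by (simp add: val_one)
  then show ?thesis
    using val_nonneg[of "-1"] by (simp add: square_eq_1_iff)
qed

lemma val_power: "val (r ^ n) = val r ^ n"
  by (induction n) (simp_all add: val_one val_mult)

end

context nonarch_normed_space
begin

lemma nrm_minus: "nrm (- x) = nrm x"
  using nrm_scale[of "-1" x] by (simp add: val_minus_one)

lemma nrm_minus_commute: "nrm (x - y) = nrm (y - x)"
  using nrm_minus[of "x - y"] by simp

lemma nrm_nonneg: "0 \<le> nrm x"
  using nrm_add_le[of x "- x"] nrm_eq_0_iff[of 0] by (simp add: nrm_minus)

lemma nrm_diff_le: "nrm (x - y) \<le> max (nrm x) (nrm y)"
  using nrm_add_le[of x "- y"] by (simp add: nrm_minus)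

lemma nrm_triangle: "nrm (x - z) \<le> max (nrm (x - y)) (nrm (y - z))"
  using nrm_add_le[of "x - y" "y - z"] by simp

text \<open>
  In contrast to the Archimedean case, step errors do not add up: the maximum of the steps bounds
  the total displacement, and no geometric series appears.
\<close>

lemma nrm_telescope_le:
  assumes "\<And>n. nrm (u (Suc n) - u n) \<le> C"
  shows "nrm (u n - u 0) \<le> C"
proof (induction n)
  case 0
  show ?case
    using order_trans[OF nrm_nonneg assms] nrm_eq_0_iff[of 0] by simp
next
  case (Suc n)
  then show ?case
    using nrm_triangle[of "u (Suc n)" "u 0" "u n"] assms[of n] by simp
qed

lemma nrm_limit_le:
  assumes lim: "(\<lambda>n. nrm (u n - l)) \<longlonglongrightarrow> 0" and le: "\<And>n. nrm (u n - w) \<le> C"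
  shows "nrm (w - l) \<le> C"
proof (rule LIMSEQ_le_const)
  have "0 \<le> C"
    using order_trans[OF nrm_nonneg le] .
  then show "(\<lambda>n. max C (nrm (u n - l))) \<longlonglongrightarrow> C"
    using tendsto_max[OF tendsto_const[of C] lim] by simp
  have "nrm (w - l) \<le> max C (nrm (u n - l))" for n
    using nrm_triangle[of w l "u n"] nrm_minus_commute[of w "u n"] le[of n] by simp
  then show "\<exists>N. \<forall>n\<ge>N. nrm (w - l) \<le> max C (nrm (u n - l))"
    by blast
qed

text \<open>
  The vector \<open>c - a - b\<close> does not depend on \<open>n\<close> and is a combination of four vectors whose norms
  tend to zero.
\<close>

lemma nrm_limit_add:
  assumes lim: "(\<lambda>n. nrm (u n - a)) \<longlonglongrightarrow> 0" "(\<lambda>n. nrm (v n - b)) \<longlonglongrightarrow> 0"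
      "(\<lambda>n. nrm (w n - c)) \<longlonglongrightarrow> 0"
    and defect: "(\<lambda>n. nrm (w n - u n - v n)) \<longlonglongrightarrow> 0"
  shows "c = a + b"
proof -
  define m where "m n = max (max (nrm (w n - c)) (nrm (w n - u n - v n)))
    (max (nrm (u n - a)) (nrm (v n - b)))" for n
  have "m \<longlonglongrightarrow> max (max 0 0) (max 0 0)"
    unfolding m_def by (intro tendsto_max lim defect)
  then have "m \<longlonglongrightarrow> 0"
    by simp
  moreover have "nrm (c - a - b) \<le> m n" for n
  proof -
    have "c - a - b = ((w n - u n - v n) - (w n - c)) + ((u n - a) + (v n - b))"
      by simp
    then have "nrm (c - a - b)
        \<le> max (nrm ((w n - u n - v n) - (w n - c))) (nrm ((u n - a) + (v n - b)))"
      using nrm_add_le by metis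
    then show ?thesis
      using nrm_diff_le[of "w n - u n - v n" "w n - c"] nrm_add_le[of "u n - a" "v n - b"]
      unfolding m_def by linarith
  qed
  ultimately have "nrm (c - a - b) \<le> 0"
    by (intro LIMSEQ_le_const[of m 0]) auto
  then have "c - a - b = 0"
    using nrm_nonneg[of "c - a - b"] nrm_eq_0_iff by force
  then show ?thesis
    by (simp add: algebra_simps)
qed

end

section \<open>Cauchy's equation on a group with halving\<close>

text \<open>
  Below, the iterates of a halving map \<open>h\<close> play the role of division by \<open>2\<^sup>n\<close>.  This lemma is the
  source of all decay: the contraction of the control function \<open>g\<close> along \<open>h\<close> absorbs the factor
  \<open>\<bar>2\<bar>\<^sup>n\<close> that comes from multiplying by \<open>2\<^sup>n\<close>.  The type of the argument of \<open>g\<close> is left arbitrary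
  because \<open>g\<close> has to cover functions of one point and of a pair of points.
\<close>

lemma (in nonarch_valuation) scaled_iterate_le:
  fixes h :: "'a \<Rightarrow> 'a" and g :: "'a \<Rightarrow> real"
  assumes "(2::'k) \<noteq> 0" and "0 \<le> \<alpha>"
    and step: "\<And>p. g (h p) \<le> \<alpha> / val 2 * g p"
  shows "val 2 ^ n * g ((h ^^ n) p) \<le> \<alpha> ^ n * g p"
proof (induction n)
  case 0
  show ?case by simp
next
  case (Suc n)
  have pos: "0 < val 2"
    using val_pos[OF assms(1)] .
  have "val 2 ^ Suc n * g ((h ^^ Suc n) p)
      \<le> val 2 ^ Suc n * (\<alpha> / val 2 * g ((h ^^ n) p))"
    using step pos by (intro mult_left_mono) simp_all
  also have "\<dots> = \<alpha> * (val 2 ^ n * g ((h ^^ n) p))"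
    using pos by simp
  also have "\<dots> \<le> \<alpha> * (\<alpha> ^ n * g p)"
    using Suc \<open>0 \<le> \<alpha>\<close> by (intro mult_left_mono)
  finally show ?case by simp
qed

text \<open>
  An additive map is determined at \<open>x\<close> by its value at \<open>h\<^sup>n x\<close>, as \<open>A x = 2\<^sup>n A (h\<^sup>n x)\<close>.  Evaluating
  the bound \<open>g\<close> there and scaling back makes it arbitrarily small.
\<close>

lemma (in nonarch_normed_space) additive_eq_if_close:
  fixes h :: "'x::ab_group_add \<Rightarrow> 'x"
  assumes "(2::'k) \<noteq> 0" and half: "\<And>x. h x + h x = x"
    and "0 \<le> \<alpha>" "\<alpha> < 1" and step: "\<And>x. g (h x) \<le> \<alpha> / val 2 * g x"
    and L: "Modules.additive L" and M: "Modules.additive M"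
    and close: "\<And>x. nrm (L x - M x) \<le> g x"
  shows "L = M"
proof
  fix x
  have rescale: "scale (2 ^ n) (A ((h ^^ n) x)) = A x" if A: "Modules.additive A" for A n
  proof (induction n)
    case 0
    show ?case by simp
  next
    case (Suc n)
    have "scale 2 (A (h y)) = A y" for y
      using Modules.additive.add[OF A, of "h y" "h y"] scale_left_distrib[of 1 1 "A (h y)"]
      by (simp add: half)
    then have "scale (2 ^ Suc n) (A ((h ^^ Suc n) x)) = scale (2 ^ n) (A ((h ^^ n) x))"
      by (metis comp_apply funpow.simps(2) power_Suc2 scale_scale)
    then show ?case using Suc by simp
  qed
  have "nrm (L x - M x) \<le> \<alpha> ^ n * g x" for n
  proof -
    have "L x - M x = scale (2 ^ n) (L ((h ^^ n) x) - M ((h ^^ n) x))"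
      by (simp add: rescale L M scale_right_diff_distrib)
    then have "nrm (L x - M x) = val 2 ^ n * nrm (L ((h ^^ n) x) - M ((h ^^ n) x))"
      by (simp only: nrm_scale val_power)
    also have "\<dots> \<le> val 2 ^ n * g ((h ^^ n) x)"
      by (intro mult_left_mono close) (simp add: val_nonneg)
    also have "\<dots> \<le> \<alpha> ^ n * g x"
      using assms(1,3) step by (rule scaled_iterate_le)
    finally show ?thesis .
  qed
  moreover have "(\<lambda>n. \<alpha> ^ n * g x) \<longlonglongrightarrow> 0"
    using assms(3,4) by (intro tendsto_mult_left_zero LIMSEQ_realpow_zero)
  ultimately have "nrm (L x - M x) \<le> 0"
    by (intro LIMSEQ_le_const[of _ 0]) auto
  then show "L x = M x"
    using nrm_nonneg[of "L x - M x"] nrm_eq_0_iff[of "L x - M x"] by simp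
qed

text \<open>
  Stability of Cauchy's equation with a control function \<open>\<kappa>\<close>.  The approximants
  \<open>2\<^sup>n f (h\<^sup>n x)\<close> have additivity defect at most \<open>\<alpha>\<^sup>n \<kappa> x y\<close>.  Since \<open>x = h x + h x\<close>, the same
  estimate bounds the steps of the sequence, so that a single decay estimate yields convergence,
  additivity of the limit and its distance from \<open>f\<close>.
\<close>

lemma (in complete_nonarch_normed_space) cauchy_equation_stable:
  fixes h :: "'x::ab_group_add \<Rightarrow> 'x" and f :: "'x \<Rightarrow> 'b"
  assumes "(2::'a) \<noteq> 0"
    and h_add: "\<And>x y. h (x + y) = h x + h y" and half: "\<And>x. h x + h x = x"
    and "0 \<le> \<alpha>" "\<alpha> < 1"
    and step: "\<And>x y. \<kappa> (h x) (h y) \<le> \<alpha> / val 2 * \<kappa> x y"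
    and defect: "\<And>x y. nrm (f (x + y) - f x - f y) \<le> \<kappa> x y"
  shows "\<exists>L. Modules.additive L \<and> (\<forall>x. nrm (f x - L x) \<le> \<alpha> / val 2 * \<kappa> x x)"
proof -
  define u where "u x n = scale (2 ^ n) (f ((h ^^ n) x))" for x n
  have \<kappa>_nonneg: "0 \<le> \<kappa> x y" for x y
    using order_trans[OF nrm_nonneg defect] .
  have pow_add: "(h ^^ n) (x + y) = (h ^^ n) x + (h ^^ n) y" for n x y
    by (induction n) (simp_all add: h_add)
  have decay: "val 2 ^ n * \<kappa> ((h ^^ n) x) ((h ^^ n) y) \<le> \<alpha> ^ n * \<kappa> x y" for n x y
  proof -
    have "(map_prod h h ^^ n) (x, y) = ((h ^^ n) x, (h ^^ n) y)"
      by (induction n) simp_all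
    then show ?thesis
      using scaled_iterate_le[of \<alpha> "\<lambda>(x, y). \<kappa> x y" "map_prod h h" n "(x, y)"] assms(1,4) step
      by (simp add: split_beta)
  qed
  have u_defect: "nrm (u (x + y) n - u x n - u y n) \<le> \<alpha> ^ n * \<kappa> x y" for x y n
  proof -
    have "u (x + y) n - u x n - u y n
        = scale (2 ^ n) (f ((h ^^ n) x + (h ^^ n) y) - f ((h ^^ n) x) - f ((h ^^ n) y))"
      by (simp add: u_def pow_add scale_right_diff_distrib)
    then have "nrm (u (x + y) n - u x n - u y n) = val 2 ^ n *
        nrm (f ((h ^^ n) x + (h ^^ n) y) - f ((h ^^ n) x) - f ((h ^^ n) y))"
      by (simp only: nrm_scale val_power)
    also have "\<dots> \<le> val 2 ^ n * \<kappa> ((h ^^ n) x) ((h ^^ n) y)"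
      by (intro mult_left_mono defect) (simp add: val_nonneg)
    finally show ?thesis
      using decay[of n x y] by linarith
  qed
  have u_step: "nrm (u x (Suc n) - u x n) \<le> \<alpha> ^ n * (\<alpha> / val 2 * \<kappa> x x)" for x n
  proof -
    \<comment> \<open>Up to sign, the step at \<open>x\<close> is the defect of the \<open>n\<close>-th approximant at \<open>(h x, h x)\<close>.\<close>
    have "u x (Suc n) = u (h x) n + u (h x) n"
      using scale_left_distrib[of "2 ^ n" "2 ^ n" "f ((h ^^ Suc n) x)"]
      by (simp add: u_def funpow_swap1)
    then have "nrm (u x (Suc n) - u x n) = nrm (u (h x + h x) n - u (h x) n - u (h x) n)"
      by (subst nrm_minus_commute) (simp add: half algebra_simps)
    also have "\<dots> \<le> \<alpha> ^ n * \<kappa> (h x) (h x)"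
      by (rule u_defect)
    also have "\<dots> \<le> \<alpha> ^ n * (\<alpha> / val 2 * \<kappa> x x)"
      using step \<open>0 \<le> \<alpha>\<close> by (intro mult_left_mono) simp_all
    finally show ?thesis .
  qed
  have null: "s \<longlonglongrightarrow> 0" if "\<And>n. 0 \<le> s n" "\<And>n. s n \<le> \<alpha> ^ n * C" for s C
  proof (rule tendsto_sandwich[of "\<lambda>n. 0" s _ "\<lambda>n. \<alpha> ^ n * C"])
    show "(\<lambda>n. \<alpha> ^ n * C) \<longlonglongrightarrow> 0"
      using assms(4,5) by (intro tendsto_mult_left_zero LIMSEQ_realpow_zero)
  qed (use that in simp_all)
  have "nonarch_Cauchy nrm (u x)" for x
    unfolding nonarch_Cauchy_def using nrm_nonneg u_step by (rule null)
  then have "\<exists>l. (\<lambda>n. nrm (u x n - l)) \<longlonglongrightarrow> 0" for x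
    using nonarch_complete unfolding nonarch_convergent_def by blast
  then obtain L where L: "\<And>x. (\<lambda>n. nrm (u x n - L x)) \<longlonglongrightarrow> 0"
    by metis
  have "Modules.additive L"
  proof
    fix x y
    have "(\<lambda>n. nrm (u (x + y) n - u x n - u y n)) \<longlonglongrightarrow> 0"
      using nrm_nonneg u_defect by (rule null)
    then show "L (x + y) = L x + L y"
      by (rule nrm_limit_add[OF L L L])
  qed
  moreover have "nrm (f x - L x) \<le> \<alpha> / val 2 * \<kappa> x x" for x
  proof (rule nrm_limit_le[OF L])
    fix n
    have "\<alpha> ^ n * (\<alpha> / val 2 * \<kappa> x x) \<le> \<alpha> / val 2 * \<kappa> x x" for n
      using assms(4,5) \<kappa>_nonneg val_nonneg by (intro mult_left_le_one_le) (simp_all add: power_le_one)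
    then have "nrm (u x n - u x 0) \<le> \<alpha> / val 2 * \<kappa> x x"
      using u_step order_trans by (intro nrm_telescope_le) blast
    then show "nrm (u x n - f x) \<le> \<alpha> / val 2 * \<kappa> x x"
      by (simp add: u_def)
  qed
  ultimately show ?thesis by blast
qed

section \<open>The Cauchy-Jensen inequality\<close>

theorem theorem2p1:
  fixes val :: "'k::field \<Rightarrow> real"
    and scaleX :: "'k \<Rightarrow> 'x::ab_group_add \<Rightarrow> 'x" and normX :: "'x \<Rightarrow> real"
    and scaleY :: "'k \<Rightarrow> 'y::ab_group_add \<Rightarrow> 'y" and normY :: "'y \<Rightarrow> real"
    and \<phi> :: "'x \<Rightarrow> 'x \<Rightarrow> 'x \<Rightarrow> real" and \<alpha> :: real
    and f :: "'x \<Rightarrow> 'y"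
  assumes "nontrivial_nonarch_valuation val"
    and "(2::'k) \<noteq> 0"
    and "nonarch_normed_space val scaleX normX"
    and "complete_nonarch_normed_space val scaleY normY"
    and "\<And>x y z. 0 \<le> \<phi> x y z"
    and "\<alpha> < 1"
    and "\<And>x y z. \<phi> (scaleX (1/2) x) (scaleX (1/2) y) (scaleX (1/2) z) \<le> \<alpha> * \<phi> x y z / val 2"
    and "f 0 = 0"
    and "\<And>x y z. normY (f (scaleX (1/2) (x + y + z)) + f (scaleX (1/2) (x - y + z)) - f x - f z)
           \<le> \<phi> x y z"
  shows "\<exists>!L. Modules.additive L \<and>
           (\<forall>x. normY (f x - L x) \<le> \<alpha> * \<phi> x (scaleX 2 x) x / (val 2 - val 2 * \<alpha>))"
proof -
  interpret X: nonarch_normed_space val scaleX normX by fact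
  interpret Y: complete_nonarch_normed_space val scaleY normY by fact
  define h where "h = scaleX (1/2)"
  define \<beta> where "\<beta> = max \<alpha> 0"
  define \<kappa> where "\<kappa> x z = \<phi> x (x + z) z" for x z
  have \<beta>: "0 \<le> \<beta>" "\<beta> < 1"
    using \<open>\<alpha> < 1\<close> by (simp_all add: \<beta>_def)
  have pos: "0 < val 2"
    using X.val_pos[OF \<open>(2::'k) \<noteq> 0\<close>] .
  have h_add: "h (x + y) = h x + h y" for x y
    by (simp add: h_def X.scale_right_distrib)
  have half: "h x + h x = x" for x
    using X.scale_left_distrib[of "1/2" "1/2" x] \<open>(2::'k) \<noteq> 0\<close>
    by (simp add: h_def flip: add_divide_distrib)
  have double: "scaleX 2 x = x + x" for x
    using X.scale_left_distrib[of 1 1 x] by simp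
  \<comment> \<open>A negative contraction factor would make \<open>\<phi>\<close> negative at half of any point where it is
    positive.\<close>
  have \<phi>_zero: "\<phi> x y z = 0" if "\<alpha> < 0" for x y z
  proof (rule ccontr)
    assume "\<phi> x y z \<noteq> 0"
    then have "\<alpha> * \<phi> x y z / val 2 < 0"
      using assms(5)[of x y z] that pos by (simp add: divide_neg_pos mult_neg_pos)
    then show False
      using assms(5)[of "h x" "h y" "h z"] assms(7)[of x y z] by (simp add: h_def)
  qed
  have \<alpha>_\<beta>: "\<alpha> * \<phi> x y z = \<beta> * \<phi> x y z" for x y z
    using \<phi>_zero by (cases "\<alpha> < 0") (simp_all add: \<beta>_def)
  have step: "\<kappa> (h x) (h z) \<le> \<beta> / val 2 * \<kappa> x z" for x z
    using assms(7)[of x "x + z" z] by (simp add: \<kappa>_def \<alpha>_\<beta> flip: h_def h_add)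
  have defect: "normY (f (x + z) - f x - f z) \<le> \<kappa> x z" for x z
  proof -
    have "x + (x + z) + z = (x + z) + (x + z)"
      by (simp add: algebra_simps)
    then have "h (x + (x + z) + z) = x + z"
      by (simp only: h_add[of "x + z" "x + z"] half)
    moreover have "h (x - (x + z) + z) = 0"
      by (simp add: h_def)
    ultimately show ?thesis
      using assms(9)[of x "x + z" z] \<open>f 0 = 0\<close> by (simp add: \<kappa>_def flip: h_def)
  qed
  \<comment> \<open>The bound of the theorem, written so that the contraction of \<open>\<kappa>\<close> applies to it.\<close>
  define g where "g x = \<beta> * \<kappa> x x / (val 2 - val 2 * \<alpha>)" for x
  have bound: "\<alpha> * \<phi> x (scaleX 2 x) x / (val 2 - val 2 * \<alpha>) = g x" for x
    by (simp add: g_def \<kappa>_def double \<alpha>_\<beta>)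
  have denom: "0 < val 2 - val 2 * \<alpha>"
    using pos \<open>\<alpha> < 1\<close> by simp
  have g_step: "g (h x) \<le> \<beta> / val 2 * g x" for x
  proof -
    have "g (h x) \<le> \<beta> * (\<beta> / val 2 * \<kappa> x x) / (val 2 - val 2 * \<alpha>)"
      unfolding g_def using step \<beta> denom by (intro divide_right_mono mult_left_mono) auto
    then show ?thesis by (simp add: g_def mult_ac)
  qed
  have sharper: "\<beta> / val 2 * \<kappa> x x \<le> g x" for x
  proof (cases "\<alpha> < 0")
    case True
    then show ?thesis by (simp add: g_def \<kappa>_def \<phi>_zero)
  next
    case False
    have "\<beta> * \<kappa> x x / val 2 \<le> \<beta> * \<kappa> x x / (val 2 - val 2 * \<alpha>)"
      using False denom pos \<beta> assms(5) by (intro divide_left_mono) (simp_all add: \<kappa>_def)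
    then show ?thesis by (simp add: g_def)
  qed
  obtain L where L: "Modules.additive L" "\<And>x. normY (f x - L x) \<le> \<beta> / val 2 * \<kappa> x x"
    using Y.cauchy_equation_stable[OF assms(2) h_add half \<beta> step defect] by blast
  show ?thesis
    unfolding bound
  proof (rule ex1I)
    show "Modules.additive L \<and> (\<forall>x. normY (f x - L x) \<le> g x)"
      using L sharper order_trans by blast
  next
    fix M
    assume M: "Modules.additive M \<and> (\<forall>x. normY (f x - M x) \<le> g x)"
    have "normY (M x - L x) \<le> g x" for x
    proof -
      have "normY (M x - L x) \<le> max (normY (f x - M x)) (normY (f x - L x))"
        using Y.nrm_triangle[of "M x" "L x" "f x"] Y.nrm_minus_commute[of "M x"] by simp
      then show ?thesis
        using M L(2)[of x] sharper[of x] by (smt (verit))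
    qed
    then show "M = L"
      using Y.additive_eq_if_close[where h = h and g = g, OF assms(2) half \<beta> g_step] M L(1) by blast
  qed
qed

end
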